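(* Let $\mathscr{M}=L^2(\Omega)$, let $\mathcal{C}_0$ be a bounded self-adjoint strictly positive operator on $\mathscr{M}$ (not assumed surjective), and for each $\xi\in\mathbb{R}$ let $\mathcal{H}_0(\xi)$ be a bounded self-adjoint positive operator on $\mathscr{M}$. Define the (possibly unbounded) operator $$\mathcal{H}(\xi)=\mathcal{H}_0(\xi)+\mathcal{C}_0^{-1}$$ with domain $\mathrm{Range}(\mathcal{C}_0)$, and let $\mathcal{C}(\xi)=\mathcal{H}(\xi)^{-1}$. If $\mathcal{H}_0:\mathbb{R}\to\mathcal{L}(\mathscr{M})$ is Fréchet differentiable at every point of $\mathbb{R}$, with derivative $\dot{\mathcal{H}}_0$, then $\mathcal{C}$ is Fréchet differentiable at every $\xi\in\mathbb{R}$ and its derivative $\dot{\mathcal{C}}$ satisfies $$\dot{\mathcal{C}}(\xi)=-\mathcal{C}(\xi)\,\dot{\mathcal{H}}_0(\xi)\,\mathcal{C}(\xi)\qquad\text{for all }\xi\in\mathbb{R}.$$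
   Context: $\Omega\subset\mathbb{R}^2$ is open, bounded and convex; $\mathscr{M}=L^2(\Omega)$ is a real separable Hilbert space with inner product $\langle f,g\rangle=\int_\Omega fg\,d\boldsymbol x$. $\mathcal{L}(\mathscr{M})$ is the space of bounded linear operators on $\mathscr{M}$ with operator norm $|||\cdot|||$. A self-adjoint operator $\mathcal{A}$ is positive if $\langle\mathcal{A}f,f\rangle\ge 0$ for all $f$ in its domain, and strictly positive if $\langle\mathcal{A}f,f\rangle>0$ for all nonzero $f$ in its domain. $\mathcal{C}_0^{-1}$ is the inverse of $\mathcal{C}_0$ as a map from $\mathrm{Range}(\mathcal{C}_0)$ to $\mathscr{M}$. For every $\xi$, $\mathcal{H}(\xi)$ is a bijection from $\mathrm{Range}(\mathcal{C}_0)$ onto $\mathscr{M}$ and $\mathcal{C}(\xi)=\mathcal{H}(\xi)^{-1}$ is a bounded self-adjoint strictly positive operator on $\mathscr{M}$. An operator-valued map $\mathcal{K}:\mathbb{R}\to\mathcal{L}(\mathscr{M})$ is Fréchet differentiable at $\xi$ if there is $\mathcal{A}\in\mathcal{L}(\mathscr{M})$ with $\lim_{h\to0}\big|\big|\big|\tfrac{1}{h}(\mathcal{K}(\xi+h)-\mathcal{K}(\xi))-\mathcal{A}\big|\big|\big|=0$; then $\dot{\mathcal{K}}(\xi):=\mathcal{A}$. *)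

theory Defs
  imports "HOL-Analysis.Analysis"
begin

section \<open>The Hilbert space of square-integrable functions\<close>

definition sq_integrable :: "'a measure \<Rightarrow> ('a \<Rightarrow> real) \<Rightarrow> bool" where
  "sq_integrable N f \<longleftrightarrow> f \<in> borel_measurable N \<and> integrable N (\<lambda>x. (f x)\<^sup>2)"

lemma sq_integrable_mult:
  assumes "sq_integrable N f" "sq_integrable N g"
  shows "integrable N (\<lambda>x. f x * g x)"
proof (rule Bochner_Integration.integrable_bound)
  show "integrable N (\<lambda>x. (f x)\<^sup>2 + (g x)\<^sup>2)"
    using assms by (auto simp: sq_integrable_def)
  show "(\<lambda>x. f x * g x) \<in> borel_measurable N"
    using assms by (auto simp: sq_integrable_def)
  have "\<bar>a * b\<bar> \<le> a\<^sup>2 + b\<^sup>2" for a b :: real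
  proof -
    have "2 * (\<bar>a\<bar> * \<bar>b\<bar>) \<le> a\<^sup>2 + b\<^sup>2"
      using sum_squares_bound[of "\<bar>a\<bar>" "\<bar>b\<bar>"] by (simp add: mult.assoc)
    moreover have "0 \<le> \<bar>a\<bar> * \<bar>b\<bar>" by simp
    ultimately show ?thesis unfolding abs_mult by linarith
  qed
  then show "AE x in N. norm (f x * g x) \<le> norm ((f x)\<^sup>2 + (g x)\<^sup>2)"
    by simp
qed

lemma sq_integrable_add:
  assumes "sq_integrable N f" "sq_integrable N g"
  shows "sq_integrable N (\<lambda>x. f x + g x)"
proof -
  have "integrable N (\<lambda>x. (f x)\<^sup>2 + 2 * (f x * g x) + (g x)\<^sup>2)"
    using assms sq_integrable_mult[OF assms] by (auto simp: sq_integrable_def)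
  then show ?thesis
    using assms by (auto simp: sq_integrable_def power2_sum algebra_simps)
qed

lemma sq_integrable_scale: "sq_integrable N f \<Longrightarrow> sq_integrable N (\<lambda>x. c * f x)"
  by (auto simp: sq_integrable_def power_mult_distrib)

lemma sq_integrable_zero: "sq_integrable N (\<lambda>x. 0)"
  by (simp add: sq_integrable_def)

definition L2_rel :: "(real ^ 2 \<Rightarrow> real) \<Rightarrow> (real ^ 2 \<Rightarrow> real) \<Rightarrow> bool" where
  "L2_rel f g \<longleftrightarrow>
     sq_integrable lebesgue f \<and> sq_integrable lebesgue g \<and> (AE x in lebesgue. f x = g x)"

lemma part_equivp_L2_rel: "part_equivp L2_rel"
proof (rule part_equivpI)
  show "\<exists>f. L2_rel f f"
    by (rule exI[of _ "\<lambda>x. 0"]) (simp add: L2_rel_def sq_integrable_zero)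
  show "symp L2_rel"
    by (rule sympI) (auto simp: L2_rel_def elim: eventually_mono)
  show "transp L2_rel"
    by (rule transpI) (auto simp: L2_rel_def elim: eventually_elim2)
qed

quotient_type plane_L2 = "real ^ 2 \<Rightarrow> real" / partial: L2_rel
  by (rule part_equivp_L2_rel)

instantiation plane_L2 :: real_inner
begin

lift_definition zero_plane_L2 :: plane_L2 is "\<lambda>x. 0"
  by (simp add: L2_rel_def sq_integrable_zero)

lift_definition plus_plane_L2 :: "plane_L2 \<Rightarrow> plane_L2 \<Rightarrow> plane_L2" is "\<lambda>f g x. f x + g x"
  by (auto simp: L2_rel_def intro: sq_integrable_add elim: eventually_elim2)

lift_definition scaleR_plane_L2 :: "real \<Rightarrow> plane_L2 \<Rightarrow> plane_L2" is "\<lambda>c f x. c * f x"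
  by (auto simp: L2_rel_def intro: sq_integrable_scale elim: eventually_mono)

definition uminus_plane_L2 :: "plane_L2 \<Rightarrow> plane_L2" where
  "uminus_plane_L2 f = (-1) *\<^sub>R f"

definition minus_plane_L2 :: "plane_L2 \<Rightarrow> plane_L2 \<Rightarrow> plane_L2" where
  "minus_plane_L2 f g = f + (- g)"

lift_definition inner_plane_L2 :: "plane_L2 \<Rightarrow> plane_L2 \<Rightarrow> real"
  is "\<lambda>f g. LINT x|lebesgue. f x * g x"
  by (rule integral_cong_AE) (auto simp: L2_rel_def sq_integrable_def elim: eventually_elim2)

definition norm_plane_L2 :: "plane_L2 \<Rightarrow> real" where
  "norm_plane_L2 f = sqrt (inner f f)"

definition dist_plane_L2 :: "plane_L2 \<Rightarrow> plane_L2 \<Rightarrow> real" where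
  "dist_plane_L2 f g = norm (f - g)"

definition sgn_plane_L2 :: "plane_L2 \<Rightarrow> plane_L2" where
  "sgn_plane_L2 f = inverse (norm f) *\<^sub>R f"

definition uniformity_plane_L2 :: "(plane_L2 \<times> plane_L2) filter" where
  "uniformity_plane_L2 = (INF e\<in>{0<..}. principal {(f, g). dist f g < e})"

definition open_plane_L2 :: "plane_L2 set \<Rightarrow> bool" where
  "open_plane_L2 U \<longleftrightarrow> (\<forall>f\<in>U. \<forall>\<^sub>F (f', g) in uniformity. f' = f \<longrightarrow> g \<in> U)"

instance
proof
  fix a b c :: plane_L2 and r s :: real
  show "a + b + c = a + (b + c)"
    by transfer (auto simp: L2_rel_def add.assoc intro!: sq_integrable_add)
  show "a + b = b + a"
    by transfer (auto simp: L2_rel_def add.commute intro!: sq_integrable_add)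
  show "0 + a = a"
    by transfer (auto simp: L2_rel_def)
  show "- a + a = 0"
    unfolding uminus_plane_L2_def
    by transfer (auto simp: L2_rel_def intro!: sq_integrable_zero)
  show "a - b = a + - b" by (fact minus_plane_L2_def)
  show "r *\<^sub>R (a + b) = r *\<^sub>R a + r *\<^sub>R b"
    by transfer (auto simp: L2_rel_def distrib_left intro!: sq_integrable_add sq_integrable_scale)
  show "(r + s) *\<^sub>R a = r *\<^sub>R a + s *\<^sub>R a"
    by transfer (auto simp: L2_rel_def distrib_right intro!: sq_integrable_add sq_integrable_scale)
  show "r *\<^sub>R s *\<^sub>R a = (r * s) *\<^sub>R a"
    by transfer (auto simp: L2_rel_def mult.assoc intro!: sq_integrable_scale)
  show "1 *\<^sub>R a = a"
    by transfer (auto simp: L2_rel_def)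
  show "dist a b = norm (a - b)" by (fact dist_plane_L2_def)
  show "sgn a = inverse (norm a) *\<^sub>R a" by (fact sgn_plane_L2_def)
  show "(uniformity :: (plane_L2 \<times> plane_L2) filter)
      = (INF e\<in>{0<..}. principal {(f, g). dist f g < e})"
    by (fact uniformity_plane_L2_def)
  show "open U \<longleftrightarrow> (\<forall>f\<in>U. \<forall>\<^sub>F (f', g) in uniformity. f' = f \<longrightarrow> g \<in> U)" for U :: "plane_L2 set"
    by (fact open_plane_L2_def)
  show "inner a b = inner b a"
    by transfer (simp add: mult.commute)
  show "inner (a + b) c = inner a c + inner b c"
    by transfer (auto simp: L2_rel_def distrib_right sq_integrable_mult)
  show "inner (r *\<^sub>R a) b = r * inner a b"
    by transfer (auto simp: L2_rel_def mult.assoc)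
  show "0 \<le> inner a a"
    by transfer (auto intro!: integral_nonneg_AE)
  show "inner a a = 0 \<longleftrightarrow> a = 0"
  proof transfer
    fix f :: "real ^ 2 \<Rightarrow> real"
    assume "L2_rel f f"
    then have "sq_integrable lebesgue f" by (simp add: L2_rel_def)
    then show "(LINT x|lebesgue. f x * f x) = 0 \<longleftrightarrow> L2_rel f (\<lambda>x. 0)"
      using integral_nonneg_eq_0_iff_AE[of lebesgue "\<lambda>x. f x * f x"]
      by (auto simp: L2_rel_def sq_integrable_zero sq_integrable_def power2_eq_square)
  qed
  show "norm a = sqrt (inner a a)" by (fact norm_plane_L2_def)
qed

end

definition zero_extension :: "'a set \<Rightarrow> ('a \<Rightarrow> real) \<Rightarrow> 'a \<Rightarrow> real" where
  "zero_extension \<Omega> f = (\<lambda>x. if x \<in> \<Omega> then f x else 0)"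

text \<open>
  A type cannot depend on \<open>\<Omega>\<close>, so \<open>L\<^sup>2(\<Omega>)\<close> is realised inside \<open>L\<^sup>2(\<real>\<^sup>2)\<close> by extending
  functions by zero. The lemmas \<open>L2_class_eq_iff\<close> and \<open>inner_L2_class\<close> show that equality and
  inner product of these classes are those of \<open>L\<^sup>2(\<Omega>)\<close>.
\<close>

definition L2_class :: "(real ^ 2) set \<Rightarrow> (real ^ 2 \<Rightarrow> real) \<Rightarrow> plane_L2" where
  "L2_class \<Omega> f = abs_plane_L2 (zero_extension \<Omega> f)"

definition L2 :: "(real ^ 2) set \<Rightarrow> plane_L2 set" where
  "L2 \<Omega> = L2_class \<Omega> ` {f. sq_integrable (lebesgue_on \<Omega>) f}"

lemma sq_integrable_zero_extension:
  fixes f :: "real ^ 2 \<Rightarrow> real"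
  assumes "\<Omega> \<in> sets lebesgue" "sq_integrable (lebesgue_on \<Omega>) f"
  shows "sq_integrable lebesgue (zero_extension \<Omega> f)"
proof -
  have "zero_extension \<Omega> f \<in> borel_measurable lebesgue"
    using assms by (simp add: zero_extension_def sq_integrable_def borel_measurable_if)
  moreover have "integrable lebesgue (\<lambda>x. indicat_real \<Omega> x * (f x)\<^sup>2)"
    using assms by (simp add: sq_integrable_def integrable_restrict_space)
  moreover have "(\<lambda>x. (zero_extension \<Omega> f x)\<^sup>2) = (\<lambda>x. indicat_real \<Omega> x * (f x)\<^sup>2)"
    by (auto simp: zero_extension_def)
  ultimately show ?thesis
    by (simp add: sq_integrable_def)
qed

lemma L2_class_eq_iff:
  assumes "\<Omega> \<in> sets lebesgue"
    and "sq_integrable (lebesgue_on \<Omega>) f" "sq_integrable (lebesgue_on \<Omega>) g"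
  shows "L2_class \<Omega> f = L2_class \<Omega> g \<longleftrightarrow> (AE x in lebesgue_on \<Omega>. f x = g x)"
proof -
  have "L2_class \<Omega> f = L2_class \<Omega> g \<longleftrightarrow> L2_rel (zero_extension \<Omega> f) (zero_extension \<Omega> g)"
    unfolding L2_class_def
    using Quotient_rel[OF Quotient_plane_L2,
        of "zero_extension \<Omega> f" "zero_extension \<Omega> g"]
      sq_integrable_zero_extension[OF assms(1,2)] sq_integrable_zero_extension[OF assms(1,3)]
    by (auto simp: L2_rel_def)
  also have "\<dots> \<longleftrightarrow> (AE x in lebesgue. x \<in> \<Omega> \<longrightarrow> f x = g x)"
    using assms sq_integrable_zero_extension by (auto simp: L2_rel_def zero_extension_def elim: eventually_mono)
  also have "\<dots> \<longleftrightarrow> (AE x in lebesgue_on \<Omega>. f x = g x)"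
    using assms by (simp add: AE_restrict_space_iff)
  finally show ?thesis .
qed

lemma inner_L2_class:
  assumes "\<Omega> \<in> sets lebesgue"
    and "sq_integrable (lebesgue_on \<Omega>) f" "sq_integrable (lebesgue_on \<Omega>) g"
  shows "inner (L2_class \<Omega> f) (L2_class \<Omega> g) = (LINT x|lebesgue_on \<Omega>. f x * g x)"
proof -
  have "inner (L2_class \<Omega> f) (L2_class \<Omega> g)
      = (LINT x|lebesgue. zero_extension \<Omega> f x * zero_extension \<Omega> g x)"
    unfolding L2_class_def
    using assms sq_integrable_zero_extension by (intro inner_plane_L2.abs_eq) (auto simp: L2_rel_def)
  also have "\<dots> = (LINT x|lebesgue. indicat_real \<Omega> x * (f x * g x))"
    by (rule Bochner_Integration.integral_cong) (auto simp: zero_extension_def)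
  also have "\<dots> = (LINT x|lebesgue_on \<Omega>. f x * g x)"
    using assms by (simp add: integral_restrict_space)
  finally show ?thesis .
qed

section \<open>Operators on a subspace\<close>

text \<open>
  Operators with domain \<open>D\<close> are total functions of which only the values on \<open>D\<close> matter.
  The predicate \<open>self_adjoint\<close> is meant for operators defined on all of \<open>M\<close>, where symmetry and
  self-adjointness coincide.
\<close>

definition bounded_operator :: "'v::real_normed_vector set \<Rightarrow> ('v \<Rightarrow> 'v) \<Rightarrow> bool" where
  "bounded_operator M T \<longleftrightarrow>
     (\<forall>f\<in>M. T f \<in> M) \<and>
     (\<forall>f\<in>M. \<forall>g\<in>M. T (f + g) = T f + T g) \<and>
     (\<forall>c. \<forall>f\<in>M. T (c *\<^sub>R f) = c *\<^sub>R T f) \<and>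
     (\<exists>B. \<forall>f\<in>M. norm (T f) \<le> B * norm f)"

definition operator_norm :: "'v::real_normed_vector set \<Rightarrow> ('v \<Rightarrow> 'v) \<Rightarrow> real" where
  "operator_norm M T = (SUP f\<in>{f \<in> M. norm f \<le> 1}. norm (T f))"

definition self_adjoint :: "'v::real_inner set \<Rightarrow> ('v \<Rightarrow> 'v) \<Rightarrow> bool" where
  "self_adjoint M T \<longleftrightarrow> (\<forall>f\<in>M. \<forall>g\<in>M. inner (T f) g = inner f (T g))"

definition positive_operator :: "'v::real_inner set \<Rightarrow> ('v \<Rightarrow> 'v) \<Rightarrow> bool" where
  "positive_operator D T \<longleftrightarrow> (\<forall>f\<in>D. inner (T f) f \<ge> 0)"

definition strictly_positive_operator :: "'v::real_inner set \<Rightarrow> ('v \<Rightarrow> 'v) \<Rightarrow> bool" where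
  "strictly_positive_operator D T \<longleftrightarrow> (\<forall>f\<in>D. f \<noteq> 0 \<longrightarrow> inner (T f) f > 0)"

definition has_frechet_derivative ::
    "'v::real_normed_vector set \<Rightarrow> (real \<Rightarrow> 'v \<Rightarrow> 'v) \<Rightarrow> ('v \<Rightarrow> 'v) \<Rightarrow> real \<Rightarrow> bool" where
  "has_frechet_derivative M K A \<xi> \<longleftrightarrow>
     (\<forall>\<eta>. bounded_operator M (K \<eta>)) \<and> bounded_operator M A \<and>
     ((\<lambda>h. operator_norm M (\<lambda>f. (1 / h) *\<^sub>R (K (\<xi> + h) f - K \<xi> f) - A f)) \<longlongrightarrow> 0) (at 0)"

text \<open>The domain of \<open>sum_op M C\<^sub>0 H\<^sub>0 \<xi>\<close> is \<open>C\<^sub>0 ` M\<close>.\<close>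

definition sum_op ::
    "'v::real_normed_vector set \<Rightarrow> ('v \<Rightarrow> 'v) \<Rightarrow> (real \<Rightarrow> 'v \<Rightarrow> 'v) \<Rightarrow> real \<Rightarrow> 'v \<Rightarrow> 'v" where
  "sum_op M C\<^sub>0 H\<^sub>0 \<xi> f = H\<^sub>0 \<xi> f + inv_into M C\<^sub>0 f"

definition inverse_sum_op ::
    "'v::real_normed_vector set \<Rightarrow> ('v \<Rightarrow> 'v) \<Rightarrow> (real \<Rightarrow> 'v \<Rightarrow> 'v) \<Rightarrow> real \<Rightarrow> 'v \<Rightarrow> 'v" where
  "inverse_sum_op M C\<^sub>0 H\<^sub>0 \<xi> = inv_into (C\<^sub>0 ` M) (sum_op M C\<^sub>0 H\<^sub>0 \<xi>)"

end

theory Submission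
  imports Defs
begin

text \<open>
  Writing elements of the domain of \<open>H(\<xi>)\<close> as \<open>C\<^sub>0 g\<close> turns \<open>H(\<xi>) u = f\<close> into
  \<open>g + H\<^sub>0(\<xi>) C\<^sub>0 g = f\<close>, an equation for bounded operators. Everything rests on one estimate for it
  (\<open>positive_perturbation_estimate\<close>): the norm of \<open>C\<^sub>0 g\<close> is at most \<open>B\<close> times that of \<open>f\<close>, where
  \<open>B\<close> bounds \<open>C\<^sub>0\<close>. Pairing the equation with \<open>C\<^sub>0 g\<close> and dropping the positive term from \<open>H\<^sub>0(\<xi>)\<close>
  bounds \<open>\<langle>C\<^sub>0 g, g\<rangle>\<close> by \<open>\<langle>C\<^sub>0 g, f\<rangle>\<close>, and \<open>\<langle>C\<^sub>0 g, g\<rangle>\<close> controls the norm of \<open>C\<^sub>0 g\<close> by the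
  Cauchy-Schwarz inequality for the form of \<open>C\<^sub>0\<close>.

  The estimate gives injectivity, and since it is unchanged when \<open>H\<^sub>0(\<xi>)\<close> is replaced by
  \<open>t H\<^sub>0(\<xi>)\<close> with \<open>0 \<le> t \<le> 1\<close>, the method of continuity gives surjectivity. Thus \<open>C(\<xi>)\<close> is
  everywhere defined and satisfies the bound \<open>B\<close> for every \<open>\<xi>\<close>; this uniformity replaces any separate
  proof that \<open>C\<close> is continuous. The resolvent identity
  \<open>C(\<eta>) - C(\<xi>) = - C(\<eta>) (H\<^sub>0(\<eta>) - H\<^sub>0(\<xi>)) C(\<xi>)\<close>, applied twice, writes the error of the
  difference quotient of \<open>C\<close> through the error of the difference quotient of \<open>H\<^sub>0\<close>.

  Surjectivity needs a complete space: on the polynomials on the unit interval, with \<open>C\<^sub>0\<close> the identity and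
  \<open>H\<^sub>0\<close> multiplication by the variable, the range of \<open>1 + H\<^sub>0 C\<^sub>0\<close> does not contain the
  polynomial 1. Completeness of \<open>L\<^sup>2(\<Omega>)\<close> is the Riesz-Fischer theorem.
\<close>

section \<open>Bounded operators on a subspace\<close>

lemma bounded_operator_bound:
  assumes "bounded_operator M T"
  obtains B where "0 \<le> B" "\<And>f. f \<in> M \<Longrightarrow> norm (T f) \<le> B * norm f"
proof -
  obtain B where B: "\<forall>f\<in>M. norm (T f) \<le> B * norm f"
    using assms unfolding bounded_operator_def by blast
  have "norm (T f) \<le> max B 0 * norm f" if "f \<in> M" for f
    using B that by (meson max.cobounded1 mult_right_mono norm_ge_zero order_trans)
  then show ?thesis using that[of "max B 0"] by simp
qed

lemma bounded_operatorI:
  assumes "\<And>f. f \<in> M \<Longrightarrow> T f \<in> M"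
    and "\<And>f g. f \<in> M \<Longrightarrow> g \<in> M \<Longrightarrow> T (f + g) = T f + T g"
    and "\<And>c f. f \<in> M \<Longrightarrow> T (c *\<^sub>R f) = c *\<^sub>R T f"
    and "\<And>f. f \<in> M \<Longrightarrow> norm (T f) \<le> B * norm f"
  shows "bounded_operator M T"
  using assms unfolding bounded_operator_def by blast

lemma
  assumes "bounded_operator M T"
  shows bounded_operator_closed: "f \<in> M \<Longrightarrow> T f \<in> M"
    and bounded_operator_plus: "f \<in> M \<Longrightarrow> g \<in> M \<Longrightarrow> T (f + g) = T f + T g"
    and bounded_operator_scale: "f \<in> M \<Longrightarrow> T (c *\<^sub>R f) = c *\<^sub>R T f"
  using assms by (auto simp: bounded_operator_def)

lemma bounded_operator_minus:
  assumes "bounded_operator M T" "f \<in> M"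
  shows "T (- f) = - T f"
  using bounded_operator_scale[OF assms, of "-1"] by simp

lemma bounded_operator_diff:
  assumes "subspace M" "bounded_operator M T" "f \<in> M" "g \<in> M"
  shows "T (f - g) = T f - T g"
  using bounded_operator_plus[OF assms(2,3), of "- g"] bounded_operator_minus[OF assms(2,4)]
    subspace_neg[OF assms(1,4)] by simp

lemma bounded_operator_add_op:
  assumes M: "subspace M" and S: "bounded_operator M S" and T: "bounded_operator M T"
  shows "bounded_operator M (\<lambda>f. S f + T f)"
proof -
  obtain a where a: "\<And>f. f \<in> M \<Longrightarrow> norm (S f) \<le> a * norm f"
    using bounded_operator_bound[OF S] by blast
  obtain b where b: "\<And>f. f \<in> M \<Longrightarrow> norm (T f) \<le> b * norm f"
    using bounded_operator_bound[OF T] by blast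
  show ?thesis
  proof (rule bounded_operatorI[where B = "a + b"])
    fix f assume "f \<in> M"
    then show "norm (S f + T f) \<le> (a + b) * norm f"
      using a[of f] b[of f] norm_triangle_ineq[of "S f" "T f"] by (simp add: algebra_simps)
  qed (use S T M in \<open>auto simp: bounded_operator_def subspace_add algebra_simps\<close>)
qed

lemma bounded_operator_comp:
  assumes S: "bounded_operator M S" and T: "bounded_operator M T"
  shows "bounded_operator M (\<lambda>f. S (T f))"
proof -
  obtain a where a0: "0 \<le> a" and a: "\<And>f. f \<in> M \<Longrightarrow> norm (S f) \<le> a * norm f"
    using bounded_operator_bound[OF S] by blast
  obtain b where b: "\<And>f. f \<in> M \<Longrightarrow> norm (T f) \<le> b * norm f"
    using bounded_operator_bound[OF T] by blast
  show ?thesis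
  proof (rule bounded_operatorI[where B = "a * b"])
    fix f assume f: "f \<in> M"
    have "norm (S (T f)) \<le> a * norm (T f)"
      using a bounded_operator_closed[OF T f] by blast
    also have "\<dots> \<le> a * (b * norm f)"
      using b[OF f] a0 by (rule mult_left_mono)
    finally show "norm (S (T f)) \<le> a * b * norm f" by (simp add: mult.assoc)
  qed (use S T in \<open>auto simp: bounded_operator_def\<close>)
qed

lemma bounded_operator_scale_op:
  assumes M: "subspace M" and T: "bounded_operator M T"
  shows "bounded_operator M (\<lambda>f. c *\<^sub>R T f)"
proof (rule bounded_operator_comp[OF _ T])
  show "bounded_operator M ((*\<^sub>R) c)"
    by (rule bounded_operatorI[where B = "\<bar>c\<bar>"])
      (auto simp: subspace_scale[OF M] algebra_simps)
qed

lemma bounded_operator_uminus_op: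
  assumes "subspace M" "bounded_operator M T"
  shows "bounded_operator M (\<lambda>f. - T f)"
  using bounded_operator_scale_op[OF assms, of "-1"] by simp

lemma bounded_operator_diff_op:
  assumes "subspace M" "bounded_operator M S" "bounded_operator M T"
  shows "bounded_operator M (\<lambda>f. S f - T f)"
  using bounded_operator_add_op[OF assms(1,2) bounded_operator_uminus_op[OF assms(1,3)]] by simp

lemma operator_norm_le:
  assumes "subspace M" "0 \<le> B" "\<And>f. f \<in> M \<Longrightarrow> norm (T f) \<le> B * norm f"
  shows "operator_norm M T \<le> B"
  unfolding operator_norm_def
proof (rule cSUP_least)
  have "0 \<in> {f \<in> M. norm f \<le> 1}"
    using subspace_0[OF assms(1)] by simp
  then show "{f \<in> M. norm f \<le> 1} \<noteq> {}" by blast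
  show "norm (T f) \<le> B" if "f \<in> {f \<in> M. norm f \<le> 1}" for f
    using assms(3)[of f] that mult_left_mono[OF _ assms(2), of "norm f" 1] by simp
qed

lemma norm_le_operator_norm:
  assumes M: "subspace M" and T: "bounded_operator M T" and f: "f \<in> M"
  shows "norm (T f) \<le> operator_norm M T * norm f"
proof (cases "f = 0")
  case True
  then show ?thesis
    using bounded_operator_scale[OF T f, of 0] by simp
next
  case False
  obtain B where B0: "0 \<le> B" and B: "\<And>f. f \<in> M \<Longrightarrow> norm (T f) \<le> B * norm f"
    using bounded_operator_bound[OF T] by blast
  let ?g = "(1 / norm f) *\<^sub>R f"
  have "norm (T g) \<le> B" if "g \<in> M" "norm g \<le> 1" for g
    using B[OF that(1)] mult_left_mono[OF that(2) B0] by simp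
  then have "bdd_above ((\<lambda>f. norm (T f)) ` {f \<in> M. norm f \<le> 1})"
    by (intro bdd_aboveI2[where M = B]) auto
  moreover have "?g \<in> {f \<in> M. norm f \<le> 1}"
    using f False by (simp add: subspace_scale[OF M])
  ultimately have "norm (T ?g) \<le> operator_norm M T"
    unfolding operator_norm_def by (rule cSUP_upper[rotated])
  then show ?thesis
    using bounded_operator_scale[OF T f, of "1 / norm f"] False by (simp add: field_simps)
qed

lemma operator_norm_nonneg:
  assumes M: "subspace M" and T: "bounded_operator M T"
  shows "0 \<le> operator_norm M T"
proof -
  obtain B where B0: "0 \<le> B" and B: "\<And>f. f \<in> M \<Longrightarrow> norm (T f) \<le> B * norm f"
    using bounded_operator_bound[OF T] by blast
  have "norm (T g) \<le> B" if "g \<in> M" "norm g \<le> 1" for g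
    using B[OF that(1)] mult_left_mono[OF that(2) B0] by simp
  then have "bdd_above ((\<lambda>f. norm (T f)) ` {f \<in> M. norm f \<le> 1})"
    by (intro bdd_aboveI2[where M = B]) auto
  then have "norm (T 0) \<le> operator_norm M T"
    unfolding operator_norm_def using subspace_0[OF M] by (intro cSUP_upper) auto
  then show ?thesis
    using norm_ge_zero order_trans by blast
qed

section \<open>Positive operators and an a priori estimate\<close>

text \<open>
  The quadratic form of \<open>T\<close> at \<open>x f + y g\<close> is nonnegative for all reals \<open>x\<close>, \<open>y\<close>, so its
  discriminant is nonpositive.
\<close>

lemma positive_cauchy_schwarz:
  assumes M: "subspace M" and T: "bounded_operator M T" and "self_adjoint M T" "positive_operator M T"
    and f: "f \<in> M" and g: "g \<in> M"
  shows "(inner (T f) g)\<^sup>2 \<le> inner (T f) f * inner (T g) g"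
proof -
  define a where "a = inner (T f) f"
  define b where "b = inner (T f) g"
  define c where "c = inner (T g) g"
  have sym: "inner (T g) f = b"
    using assms(3) f g by (simp add: self_adjoint_def b_def inner_commute)
  have quad: "0 \<le> x\<^sup>2 * a + 2 * x * y * b + y\<^sup>2 * c" for x y
  proof -
    have xf: "x *\<^sub>R f \<in> M" and yg: "y *\<^sub>R g \<in> M"
      using f g subspace_scale[OF M] by auto
    have "0 \<le> inner (T (x *\<^sub>R f + y *\<^sub>R g)) (x *\<^sub>R f + y *\<^sub>R g)"
      using assms(4) subspace_add[OF M xf yg] by (simp add: positive_operator_def)
    also have "T (x *\<^sub>R f + y *\<^sub>R g) = x *\<^sub>R T f + y *\<^sub>R T g"
      using xf yg f g by (simp add: bounded_operator_plus[OF T] bounded_operator_scale[OF T])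
    also have "inner \<dots> (x *\<^sub>R f + y *\<^sub>R g) = x\<^sup>2 * a + 2 * x * y * b + y\<^sup>2 * c"
      by (simp add: inner_add_left inner_add_right sym flip: a_def b_def c_def)
        (simp add: power2_eq_square algebra_simps)
    finally show ?thesis .
  qed
  have c0: "0 \<le> c"
    using quad[of 0 1] by simp
  show ?thesis
  proof (cases "c = 0")
    case False
    have "0 \<le> c * (c * a - b\<^sup>2)"
      using quad[of c "- b"] by (simp add: power2_eq_square algebra_simps)
    then have "b\<^sup>2 \<le> a * c"
      using False c0 by (simp add: zero_le_mult_iff mult.commute)
    then show ?thesis by (simp add: a_def b_def c_def)
  next
    case True
    have "b = 0"
    proof (rule ccontr)
      assume "b \<noteq> 0"
      \<comment> \<open>With no quadratic term in \<open>y\<close>, this \<open>y\<close> makes the form equal to \<open>- 1\<close>.\<close>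
      moreover have "0 \<le> a + 2 * (- (a + 1) / (2 * b)) * b"
        using quad[of 1 "- (a + 1) / (2 * b)"] True by simp
      ultimately show False by (simp add: field_simps)
    qed
    then show ?thesis using True by (simp add: b_def c_def)
  qed
qed

text \<open>
  The Cauchy-Schwarz inequality of the form of \<open>T\<close> is used with second argument \<open>T f\<close>. It replaces
  the argument through a square root of \<open>T\<close>.
\<close>

lemma norm_positive_operator_le:
  assumes M: "subspace M" and T: "bounded_operator M T" and "self_adjoint M T" "positive_operator M T"
    and B: "\<And>f. f \<in> M \<Longrightarrow> norm (T f) \<le> B * norm f"
    and f: "f \<in> M"
  shows "(norm (T f))\<^sup>2 \<le> B * inner (T f) f"
proof (cases "T f = 0")
  case False
  have Tf: "T f \<in> M" using bounded_operator_closed[OF T f] .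
  have p0: "0 \<le> inner (T f) f"
    using assms(4) f by (simp add: positive_operator_def)
  have "inner (T (T f)) (T f) \<le> norm (T (T f)) * norm (T f)"
    by (rule norm_cauchy_schwarz)
  also have "\<dots> \<le> B * norm (T f) * norm (T f)"
    using B[OF Tf] by (rule mult_right_mono) simp
  finally have *: "inner (T (T f)) (T f) \<le> B * (norm (T f))\<^sup>2"
    by (simp add: power2_eq_square mult.assoc)
  have "(norm (T f))\<^sup>2 * (norm (T f))\<^sup>2 = (inner (T f) (T f))\<^sup>2"
    by (simp add: dot_square_norm power2_eq_square)
  also have "\<dots> \<le> inner (T f) f * inner (T (T f)) (T f)"
    by (rule positive_cauchy_schwarz[OF M T assms(3,4) f Tf])
  also have "\<dots> \<le> inner (T f) f * (B * (norm (T f))\<^sup>2)"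
    using * p0 by (rule mult_left_mono)
  finally have "(norm (T f))\<^sup>2 * (norm (T f))\<^sup>2 \<le> (B * inner (T f) f) * (norm (T f))\<^sup>2"
    by (simp add: algebra_simps)
  moreover have "0 < (norm (T f))\<^sup>2" using False by simp
  ultimately show ?thesis by (rule mult_right_le_imp_le)
qed simp

text \<open>
  The bound involves only \<open>T\<close>, not the size of the positive perturbation \<open>S\<close>. Hence it holds
  uniformly in \<open>\<xi>\<close>, and along the whole homotopy \<open>t S\<close> with \<open>0 \<le> t \<le> 1\<close>.
\<close>

lemma positive_perturbation_estimate:
  assumes M: "subspace M" and T: "bounded_operator M T" and "self_adjoint M T" "positive_operator M T"
    and B0: "0 \<le> B" and B: "\<And>f. f \<in> M \<Longrightarrow> norm (T f) \<le> B * norm f"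
    and "positive_operator M S" and g: "g \<in> M"
  shows "norm (T g) \<le> B * norm (g + S (T g))"
proof (cases "T g = 0")
  case False
  have "0 \<le> inner (S (T g)) (T g)"
    using assms(7) bounded_operator_closed[OF T g] by (simp add: positive_operator_def)
  then have "inner (T g) g \<le> inner (T g) (g + S (T g))"
    by (simp add: inner_add_right inner_commute)
  also have "\<dots> \<le> norm (T g) * norm (g + S (T g))"
    by (rule norm_cauchy_schwarz)
  finally have "B * inner (T g) g \<le> B * (norm (T g) * norm (g + S (T g)))"
    using B0 by (rule mult_left_mono)
  with norm_positive_operator_le[OF M T assms(3,4) B g]
  have "norm (T g) * norm (T g) \<le> norm (T g) * (B * norm (g + S (T g)))"
    by (simp add: power2_eq_square algebra_simps)
  then show ?thesis using False by (simp add: mult_le_cancel_left)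
qed (use B0 in simp)

section \<open>The method of continuity\<close>

text \<open>
  The estimate at \<open>t\<close> makes the inverse of \<open>1 + t S\<close> a \<open>K\<close>-Lipschitz map, so the equation at
  \<open>t + d\<close>, rewritten as \<open>g = (1 + t S)\<^sup>-\<^sup>1 (f - d S g)\<close>, is solved by iterating a contraction.
\<close>

lemma continuity_step:
  fixes M :: "'v::real_normed_vector set"
  assumes M: "subspace M" "complete M" and S: "bounded_operator M S"
    and b: "\<And>g. g \<in> M \<Longrightarrow> norm (S g) \<le> b * norm g"
    and K0: "0 \<le> K"
    and K: "\<And>g. g \<in> M \<Longrightarrow> norm g \<le> K * norm (g + t *\<^sub>R S g)"
    and b0: "0 \<le> b" and d0: "0 \<le> d" and small: "K * d * b < 1"
    and onto: "M \<subseteq> (\<lambda>g. g + t *\<^sub>R S g) ` M"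
  shows "M \<subseteq> (\<lambda>g. g + (t + d) *\<^sub>R S g) ` M"
proof
  fix f assume f: "f \<in> M"
  let ?A = "\<lambda>g. g + t *\<^sub>R S g"
  define R where "R = inv_into M ?A"
  have R: "R x \<in> M" "?A (R x) = x" if "x \<in> M" for x
    using onto that inv_into_into[of x ?A M] f_inv_into_f[of x ?A M] by (auto simp: R_def)
  have R_lip: "norm (R x - R y) \<le> K * norm (x - y)" if "x \<in> M" "y \<in> M" for x y
  proof -
    have "?A (R x - R y) = ?A (R x) - ?A (R y)"
      using R that by (simp add: bounded_operator_diff[OF M(1) S] algebra_simps)
    then show ?thesis
      using K[of "R x - R y"] R that subspace_diff[OF M(1)] by simp
  qed
  have in_M: "f - d *\<^sub>R S g \<in> M" if "g \<in> M" for g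
    using M(1) f that bounded_operator_closed[OF S] by (simp add: subspace_diff subspace_scale)
  \<comment> \<open>The equation for \<open>t + d\<close> is a fixed point equation for the resolvent at \<open>t\<close>.\<close>
  have "\<exists>!g\<in>M. R (f - d *\<^sub>R S g) = g"
  proof (rule Banach_fix[OF M(2)])
    show "M \<noteq> {}" using f by blast
    show "0 \<le> K * d * b" using K0 d0 b0 by simp
    show "(\<lambda>g. R (f - d *\<^sub>R S g)) ` M \<subseteq> M" using R in_M by blast
    show "dist (R (f - d *\<^sub>R S g)) (R (f - d *\<^sub>R S h)) \<le> K * d * b * dist g h"
      if "g \<in> M" "h \<in> M" for g h
    proof -
      have "(f - d *\<^sub>R S g) - (f - d *\<^sub>R S h) = d *\<^sub>R S (h - g)"
        using that by (simp add: bounded_operator_diff[OF M(1) S] scaleR_diff_right)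
      then have "norm (R (f - d *\<^sub>R S g) - R (f - d *\<^sub>R S h)) \<le> K * norm (d *\<^sub>R S (h - g))"
        using R_lip[OF in_M[OF that(1)] in_M[OF that(2)]] by simp
      also have "\<dots> \<le> K * (d * (b * norm (h - g)))"
        using b[of "h - g"] that subspace_diff[OF M(1)] K0 d0
        by (auto intro!: mult_left_mono)
      finally show ?thesis by (simp add: dist_norm norm_minus_commute mult.assoc)
    qed
  qed (use small in auto)
  then obtain g where g: "g \<in> M" "R (f - d *\<^sub>R S g) = g" by blast
  then have "g + t *\<^sub>R S g = f - d *\<^sub>R S g"
    using R(2)[OF in_M[OF g(1)]] by simp
  then have "f = g + (t + d) *\<^sub>R S g" by (simp add: algebra_simps)
  then show "f \<in> (\<lambda>g. g + (t + d) *\<^sub>R S g) ` M" using g(1) by blast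
qed

text \<open>
  The length of an admissible step depends only on \<open>K\<close> and a bound of \<open>S\<close>, so finitely many equal
  steps lead from the identity at \<open>t = 0\<close> to \<open>1 + S\<close>.
\<close>

lemma method_of_continuity:
  fixes M :: "'v::real_normed_vector set"
  assumes M: "subspace M" "complete M" and S: "bounded_operator M S"
    and K0: "0 \<le> K"
    and K: "\<And>t g. 0 \<le> t \<Longrightarrow> t \<le> 1 \<Longrightarrow> g \<in> M \<Longrightarrow> norm g \<le> K * norm (g + t *\<^sub>R S g)"
  shows "M \<subseteq> (\<lambda>g. g + S g) ` M"
proof -
  obtain b where b0: "0 \<le> b" and b: "\<And>g. g \<in> M \<Longrightarrow> norm (S g) \<le> b * norm g"
    using bounded_operator_bound[OF S] by blast
  obtain n :: nat where n: "K * b < real n"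
    using reals_Archimedean2 by blast
  then have npos: "0 < real n"
    using mult_nonneg_nonneg[OF K0 b0] by linarith
  let ?d = "1 / real n"
  have "M \<subseteq> (\<lambda>g. g + (real k * ?d) *\<^sub>R S g) ` M" if "k \<le> n" for k
    using that
  proof (induction k)
    case (Suc k)
    have "M \<subseteq> (\<lambda>g. g + (real k * ?d + ?d) *\<^sub>R S g) ` M"
    proof (rule continuity_step[OF M S b K0 _ b0])
      show "norm g \<le> K * norm (g + (real k * ?d) *\<^sub>R S g)" if "g \<in> M" for g
        using Suc.prems npos that by (intro K) auto
      show "K * ?d * b < 1" using n npos by (simp add: field_simps)
    qed (use Suc in auto)
    then show ?case by (simp add: add_divide_distrib add.commute)
  qed (auto simp: image_iff)
  from this[of n] show ?thesis using npos by simp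
qed

section \<open>The inverse of a positive operator plus a strictly positive inverse\<close>

lemma strictly_positive_imp_positive:
  assumes "strictly_positive_operator D T"
  shows "positive_operator D T"
  unfolding positive_operator_def
proof
  fix f assume "f \<in> D"
  then show "0 \<le> inner (T f) f"
    using assms by (cases "f = 0") (auto simp: strictly_positive_operator_def less_imp_le)
qed

lemma strictly_positive_inj_on:
  assumes M: "subspace M" and T: "bounded_operator M T" and "strictly_positive_operator M T"
  shows "inj_on T M"
proof (rule inj_onI)
  fix f g assume fg: "f \<in> M" "g \<in> M" "T f = T g"
  then have "inner (T (f - g)) (f - g) = 0"
    using bounded_operator_diff[OF M T] by simp
  then show "f = g"
    using assms(3) subspace_diff[OF M fg(1,2)] by (force simp: strictly_positive_operator_def)
qed

locale positive_perturbation =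
  fixes M :: "'v::real_inner set" and C\<^sub>0 :: "'v \<Rightarrow> 'v" and H\<^sub>0 :: "real \<Rightarrow> 'v \<Rightarrow> 'v"
  assumes subspace: "subspace M" and complete: "complete M"
    and C0_bounded: "bounded_operator M C\<^sub>0"
    and C0_self_adjoint: "self_adjoint M C\<^sub>0"
    and C0_strictly_positive: "strictly_positive_operator M C\<^sub>0"
    and H0_bounded: "\<And>\<xi>. bounded_operator M (H\<^sub>0 \<xi>)"
    and H0_positive: "\<And>\<xi>. positive_operator M (H\<^sub>0 \<xi>)"
begin

abbreviation "C \<equiv> inverse_sum_op M C\<^sub>0 H\<^sub>0"

lemma C0_positive: "positive_operator M C\<^sub>0"
  by (rule strictly_positive_imp_positive[OF C0_strictly_positive])

text \<open>
  On the domain \<open>C\<^sub>0 ` M\<close> the unbounded operator is expressed by bounded ones; the lemmas below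
  always parametrise the domain in this way.
\<close>

lemma sum_op_C0:
  assumes "g \<in> M"
  shows "sum_op M C\<^sub>0 H\<^sub>0 \<xi> (C\<^sub>0 g) = g + H\<^sub>0 \<xi> (C\<^sub>0 g)"
  using strictly_positive_inj_on[OF subspace C0_bounded C0_strictly_positive] assms
  by (simp add: sum_op_def)

lemma one_plus_H0_C0_onto: "M \<subseteq> (\<lambda>g. g + H\<^sub>0 \<xi> (C\<^sub>0 g)) ` M"
proof -
  obtain B where B: "0 \<le> B" "\<And>f. f \<in> M \<Longrightarrow> norm (C\<^sub>0 f) \<le> B * norm f"
    using bounded_operator_bound[OF C0_bounded] by blast
  obtain a where a: "0 \<le> a" "\<And>f. f \<in> M \<Longrightarrow> norm (H\<^sub>0 \<xi> f) \<le> a * norm f"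
    using bounded_operator_bound[OF H0_bounded] by blast
  show ?thesis
  proof (rule method_of_continuity[OF subspace complete bounded_operator_comp[OF H0_bounded C0_bounded]])
    show "0 \<le> 1 + a * B" using a B by simp
    fix t :: real and g assume t: "0 \<le> t" "t \<le> 1" and g: "g \<in> M"
    let ?f = "g + t *\<^sub>R H\<^sub>0 \<xi> (C\<^sub>0 g)"
    have "positive_operator M (\<lambda>u. t *\<^sub>R H\<^sub>0 \<xi> u)"
      using H0_positive t by (simp add: positive_operator_def)
    from positive_perturbation_estimate[OF subspace C0_bounded C0_self_adjoint C0_positive B this g]
    have C0g: "norm (C\<^sub>0 g) \<le> B * norm ?f" .
    have "norm g \<le> norm ?f + norm (t *\<^sub>R H\<^sub>0 \<xi> (C\<^sub>0 g))"
      using norm_triangle_ineq4[of ?f "t *\<^sub>R H\<^sub>0 \<xi> (C\<^sub>0 g)"] by simp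
    also have "norm (t *\<^sub>R H\<^sub>0 \<xi> (C\<^sub>0 g)) \<le> norm (H\<^sub>0 \<xi> (C\<^sub>0 g))"
      using t by (simp add: mult_left_le_one_le)
    also have "\<dots> \<le> a * norm (C\<^sub>0 g)"
      using a(2) bounded_operator_closed[OF C0_bounded g] by blast
    also have "\<dots> \<le> a * (B * norm ?f)"
      using C0g a(1) by (rule mult_left_mono)
    finally show "norm g \<le> (1 + a * B) * norm ?f" by (simp add: algebra_simps)
  qed
qed

lemma sum_op_inj_on: "inj_on (sum_op M C\<^sub>0 H\<^sub>0 \<xi>) (C\<^sub>0 ` M)"
proof (rule inj_onI, elim imageE, hypsubst)
  fix g h assume g: "g \<in> M" and h: "h \<in> M"
    and eq: "sum_op M C\<^sub>0 H\<^sub>0 \<xi> (C\<^sub>0 g) = sum_op M C\<^sub>0 H\<^sub>0 \<xi> (C\<^sub>0 h)"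
  obtain B where B: "0 \<le> B" "\<And>f. f \<in> M \<Longrightarrow> norm (C\<^sub>0 f) \<le> B * norm f"
    using bounded_operator_bound[OF C0_bounded] by blast
  note closed = bounded_operator_closed[OF C0_bounded]
  have "(g - h) + H\<^sub>0 \<xi> (C\<^sub>0 (g - h)) = 0"
    using eq g h closed
    by (simp add: sum_op_C0 bounded_operator_diff[OF subspace C0_bounded]
        bounded_operator_diff[OF subspace H0_bounded] algebra_simps)
  then have "C\<^sub>0 (g - h) = 0"
    using positive_perturbation_estimate[OF subspace C0_bounded C0_self_adjoint C0_positive B
        H0_positive, of "g - h" \<xi>] subspace_diff[OF subspace g h]
    by simp
  then show "C\<^sub>0 g = C\<^sub>0 h"
    using bounded_operator_diff[OF subspace C0_bounded g h] by simp
qed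

lemma C_eqI: "g \<in> M \<Longrightarrow> g + H\<^sub>0 \<xi> (C\<^sub>0 g) = f \<Longrightarrow> C \<xi> f = C\<^sub>0 g"
  using inv_into_f_f[OF sum_op_inj_on, of "C\<^sub>0 g" \<xi>] sum_op_C0[of g \<xi>]
  by (simp add: inverse_sum_op_def)

lemma C_cases:
  assumes "f \<in> M"
  obtains g where "g \<in> M" "g + H\<^sub>0 \<xi> (C\<^sub>0 g) = f" "C \<xi> f = C\<^sub>0 g"
  using one_plus_H0_C0_onto[of \<xi>] assms C_eqI by (blast elim: imageE)

text \<open>
  The bound is the same for all \<open>\<xi>\<close>, which keeps the factors \<open>C (\<xi> + h)\<close> under control as
  \<open>h\<close> tends to 0.
\<close>

lemma C_norm_le:
  assumes B: "0 \<le> B" "\<And>f. f \<in> M \<Longrightarrow> norm (C\<^sub>0 f) \<le> B * norm f" and f: "f \<in> M"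
  shows "norm (C \<xi> f) \<le> B * norm f"
proof -
  obtain g where "g \<in> M" "g + H\<^sub>0 \<xi> (C\<^sub>0 g) = f" "C \<xi> f = C\<^sub>0 g"
    using C_cases[OF f] .
  then show ?thesis
    using positive_perturbation_estimate[OF subspace C0_bounded C0_self_adjoint C0_positive B
        H0_positive, of g \<xi>] by simp
qed

lemma C_bounded: "bounded_operator M (C \<xi>)"
proof -
  note closed = bounded_operator_closed[OF C0_bounded] bounded_operator_closed[OF H0_bounded]
  obtain B where B: "0 \<le> B" "\<And>f. f \<in> M \<Longrightarrow> norm (C\<^sub>0 f) \<le> B * norm f"
    using bounded_operator_bound[OF C0_bounded] by blast
  show ?thesis
  proof (rule bounded_operatorI[OF _ _ _ C_norm_le[OF B]])
    fix f assume f: "f \<in> M"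
    obtain g where g: "g \<in> M" "g + H\<^sub>0 \<xi> (C\<^sub>0 g) = f" "C \<xi> f = C\<^sub>0 g"
      using C_cases[OF f] .
    show "C \<xi> f \<in> M" using g closed by simp
    show "C \<xi> (c *\<^sub>R f) = c *\<^sub>R C \<xi> f" for c
    proof -
      have "C \<xi> (c *\<^sub>R f) = C\<^sub>0 (c *\<^sub>R g)"
        using g closed subspace_scale[OF subspace]
        by (intro C_eqI)
          (auto simp: bounded_operator_scale[OF C0_bounded] bounded_operator_scale[OF H0_bounded]
            scaleR_add_right)
      then show ?thesis using g by (simp add: bounded_operator_scale[OF C0_bounded])
    qed
    fix f' assume f': "f' \<in> M"
    obtain g' where g': "g' \<in> M" "g' + H\<^sub>0 \<xi> (C\<^sub>0 g') = f'" "C \<xi> f' = C\<^sub>0 g'"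
      using C_cases[OF f'] .
    have "C \<xi> (f + f') = C\<^sub>0 (g + g')"
      using g g' closed subspace_add[OF subspace]
      by (intro C_eqI)
        (auto simp: bounded_operator_plus[OF C0_bounded] bounded_operator_plus[OF H0_bounded]
          algebra_simps)
    then show "C \<xi> (f + f') = C \<xi> f + C \<xi> f'"
      using g g' by (simp add: bounded_operator_plus[OF C0_bounded])
  qed
qed

text \<open>
  If \<open>C\<^sub>0 g\<close> and \<open>C\<^sub>0 h\<close> solve the equations at \<open>\<xi>\<close> and \<open>\<eta>\<close> for the same
  right-hand side, then subtracting these shows that \<open>C\<^sub>0 (g - h)\<close> solves the equation at \<open>\<eta>\<close> with
  right-hand side \<open>(H\<^sub>0 \<eta> - H\<^sub>0 \<xi>) (C\<^sub>0 g)\<close>.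
\<close>

lemma resolvent_identity:
  assumes f: "f \<in> M"
  shows "C \<eta> f - C \<xi> f = - C \<eta> (H\<^sub>0 \<eta> (C \<xi> f) - H\<^sub>0 \<xi> (C \<xi> f))"
proof -
  note closed = bounded_operator_closed[OF C0_bounded] bounded_operator_closed[OF H0_bounded]
  obtain g where g: "g \<in> M" "g + H\<^sub>0 \<xi> (C\<^sub>0 g) = f" "C \<xi> f = C\<^sub>0 g"
    using C_cases[OF f] .
  obtain h where h: "h \<in> M" "h + H\<^sub>0 \<eta> (C\<^sub>0 h) = f" "C \<eta> f = C\<^sub>0 h"
    using C_cases[OF f] .
  have "C \<eta> (H\<^sub>0 \<eta> (C\<^sub>0 g) - H\<^sub>0 \<xi> (C\<^sub>0 g)) = C\<^sub>0 (g - h)"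
  proof (rule C_eqI)
    show "g - h \<in> M" using g h subspace_diff[OF subspace] by blast
    have "H\<^sub>0 \<eta> (C\<^sub>0 (g - h)) = H\<^sub>0 \<eta> (C\<^sub>0 g) - H\<^sub>0 \<eta> (C\<^sub>0 h)"
      using g h closed
      by (simp add: bounded_operator_diff[OF subspace C0_bounded]
          bounded_operator_diff[OF subspace H0_bounded])
    moreover have "g - h = H\<^sub>0 \<eta> (C\<^sub>0 h) - H\<^sub>0 \<xi> (C\<^sub>0 g)"
      using trans[OF g(2) h(2)[symmetric]] by (simp add: algebra_simps)
    ultimately show "g - h + H\<^sub>0 \<eta> (C\<^sub>0 (g - h)) = H\<^sub>0 \<eta> (C\<^sub>0 g) - H\<^sub>0 \<xi> (C\<^sub>0 g)"
      by simp
  qed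
  also have "\<dots> = C \<xi> f - C \<eta> f"
    using g h by (simp add: bounded_operator_diff[OF subspace C0_bounded])
  finally show ?thesis using g by simp
qed

section \<open>The derivative of the inverse\<close>

text \<open>
  Let \<open>D h\<close> be the error of the difference quotient of \<open>H\<^sub>0\<close>. By the resolvent identity the
  quotient of \<open>C\<close> is \<open>- C(\<xi> + h) (D h + H') C(\<xi>)\<close>, so its error is
  \<open>- C(\<xi> + h) (D h) C(\<xi>) - (C(\<xi> + h) - C(\<xi>)) H' C(\<xi>)\<close>. The first term is small with
  \<open>D h\<close>; a second use of the identity extracts a factor \<open>h\<close> from the other one.
\<close>

theorem inverse_sum_op_has_frechet_derivative:
  assumes deriv: "has_frechet_derivative M H\<^sub>0 H' \<xi>"
  shows "has_frechet_derivative M C (\<lambda>f. - C \<xi> (H' (C \<xi> f))) \<xi>"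
proof -
  have H': "bounded_operator M H'"
    using deriv by (simp add: has_frechet_derivative_def)
  define D where "D h f = (1 / h) *\<^sub>R (H\<^sub>0 (\<xi> + h) f - H\<^sub>0 \<xi> f) - H' f" for h f
  define E where "E h f = (1 / h) *\<^sub>R (C (\<xi> + h) f - C \<xi> f) - (- C \<xi> (H' (C \<xi> f)))" for h f
  define \<delta> where "\<delta> h = operator_norm M (D h)" for h
  have \<delta>_lim: "(\<delta> \<longlongrightarrow> 0) (at 0)"
    using deriv unfolding has_frechet_derivative_def \<delta>_def D_def by blast
  have D: "bounded_operator M (D h)" for h
    unfolding D_def
    by (intro bounded_operator_diff_op bounded_operator_scale_op subspace H0_bounded H')
  have CHC: "bounded_operator M (\<lambda>f. - C \<xi> (H' (C \<xi> f)))"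
    by (intro bounded_operator_uminus_op subspace bounded_operator_comp[OF C_bounded]
        bounded_operator_comp[OF H'] C_bounded)
  have E: "bounded_operator M (E h)" for h
    unfolding E_def
    by (intro bounded_operator_diff_op[OF subspace _ CHC] bounded_operator_scale_op
        bounded_operator_diff_op subspace C_bounded)
  \<comment> \<open>One constant for all the operators \<open>C \<eta>\<close>.\<close>
  obtain B where B0: "0 \<le> B" and "\<And>f. f \<in> M \<Longrightarrow> norm (C\<^sub>0 f) \<le> B * norm f"
    using bounded_operator_bound[OF C0_bounded] by blast
  then have B: "norm (C \<eta> f) \<le> B * norm f" if "f \<in> M" for \<eta> f
    using C_norm_le that by blast
  obtain a where a0: "0 \<le> a" and a: "\<And>f. f \<in> M \<Longrightarrow> norm (H' f) \<le> a * norm f"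
    using bounded_operator_bound[OF H'] by blast
  note closed = bounded_operator_closed[OF C_bounded] bounded_operator_closed[OF H']
    bounded_operator_closed[OF D] bounded_operator_closed[OF H0_bounded]
    subspace_add[OF subspace] subspace_scale[OF subspace] subspace_diff[OF subspace]
  have quotient: "(1 / h) *\<^sub>R (C (\<xi> + h) f - C \<xi> f) = - C (\<xi> + h) (D h (C \<xi> f) + H' (C \<xi> f))"
    if "f \<in> M" for h f
    using that
    by (simp add: resolvent_identity D_def closed flip: bounded_operator_scale[OF C_bounded])
  have E_le: "norm (E h f) \<le> (B * B * \<delta> h + \<bar>h\<bar> * (B * B * B * a * (\<delta> h + a))) * norm f"
    if h: "h \<noteq> 0" and f: "f \<in> M" for h f
  proof -
    define v where "v = C \<xi> f"
    define w where "w = H' v"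
    define z where "z = C \<xi> w"
    have in_M: "v \<in> M" "w \<in> M" "z \<in> M"
      using f by (auto simp: v_def w_def z_def closed)
    \<comment> \<open>The second use of the resolvent identity, now on \<open>w\<close>.\<close>
    have "C (\<xi> + h) w - C \<xi> w = h *\<^sub>R ((1 / h) *\<^sub>R (C (\<xi> + h) w - C \<xi> w))"
      using h by simp
    also have "\<dots> = - (h *\<^sub>R C (\<xi> + h) (D h z + H' z))"
      using quotient[OF in_M(2), of h] by (simp add: z_def)
    finally have *: "C \<xi> w = C (\<xi> + h) w + h *\<^sub>R C (\<xi> + h) (D h z + H' z)"
      by (simp add: algebra_simps)
    have "E h f = C \<xi> w - C (\<xi> + h) (D h v + w)"
      using quotient[OF f, of h] by (simp add: E_def v_def w_def)
    also have "\<dots> = h *\<^sub>R C (\<xi> + h) (D h z + H' z) - C (\<xi> + h) (D h v)"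
      using in_M by (subst *) (simp add: bounded_operator_plus[OF C_bounded] closed)
    finally have split: "norm (E h f)
        \<le> norm (C (\<xi> + h) (D h v)) + \<bar>h\<bar> * norm (C (\<xi> + h) (D h z + H' z))"
      using norm_triangle_ineq4[of "h *\<^sub>R C (\<xi> + h) (D h z + H' z)" "C (\<xi> + h) (D h v)"] by simp
    have first: "norm (C (\<xi> + h) (D h v)) \<le> B * (\<delta> h * (B * norm f))"
    proof -
      have "norm (C (\<xi> + h) (D h v)) \<le> B * norm (D h v)"
        using in_M by (intro B closed)
      also have "norm (D h v) \<le> \<delta> h * norm v"
        unfolding \<delta>_def by (rule norm_le_operator_norm[OF subspace D in_M(1)])
      also have "norm v \<le> B * norm f"
        unfolding v_def by (rule B[OF f])
      finally show ?thesis
        using B0 operator_norm_nonneg[OF subspace D, of h]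
        by (simp add: mult_left_mono flip: \<delta>_def)
    qed
    have second: "norm (C (\<xi> + h) (D h z + H' z)) \<le> B * ((\<delta> h + a) * (B * (a * (B * norm f))))"
    proof -
      have \<delta>0: "0 \<le> \<delta> h"
        unfolding \<delta>_def by (rule operator_norm_nonneg[OF subspace D])
      have "norm v \<le> B * norm f" unfolding v_def by (rule B[OF f])
      then have "norm w \<le> a * (B * norm f)"
        unfolding w_def using a[OF in_M(1)] mult_left_mono[OF _ a0] by (meson order_trans)
      then have z: "norm z \<le> B * (a * (B * norm f))"
        unfolding z_def using B[OF in_M(2)] mult_left_mono[OF _ B0] by (meson order_trans)
      have "norm (D h z + H' z) \<le> \<delta> h * norm z + a * norm z"
        unfolding \<delta>_def
        by (rule norm_triangle_mono[OF norm_le_operator_norm[OF subspace D in_M(3)] a[OF in_M(3)]])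
      also have "\<dots> = (\<delta> h + a) * norm z" by (simp add: algebra_simps)
      also have "\<dots> \<le> (\<delta> h + a) * (B * (a * (B * norm f)))"
        using z a0 \<delta>0 by (intro mult_left_mono) auto
      finally show ?thesis
        using B[of "D h z + H' z" "\<xi> + h"] in_M mult_left_mono[OF _ B0]
        by (meson closed order_trans)
    qed
    have "norm (E h f) \<le> B * (\<delta> h * (B * norm f)) + \<bar>h\<bar> * (B * ((\<delta> h + a) * (B * (a * (B * norm f)))))"
      using split add_mono[OF first mult_left_mono[OF second abs_ge_zero[of h]]] by (rule order_trans)
    also have "\<dots> = (B * B * \<delta> h + \<bar>h\<bar> * (B * B * B * a * (\<delta> h + a))) * norm f"
      by (simp add: algebra_simps)
    finally show ?thesis .
  qed
  have "((\<lambda>h. operator_norm M (E h)) \<longlongrightarrow> 0) (at 0)"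
  proof (rule tendsto_sandwich)
    show "\<forall>\<^sub>F h in at 0. 0 \<le> operator_norm M (E h)"
      by (simp add: operator_norm_nonneg[OF subspace E])
    have "operator_norm M (E h) \<le> B * B * \<delta> h + \<bar>h\<bar> * (B * B * B * a * (\<delta> h + a))"
      if "h \<noteq> 0" for h
      using a0 B0 operator_norm_nonneg[OF subspace D, of h] E_le[OF that]
      by (intro operator_norm_le[OF subspace]) (auto simp flip: \<delta>_def)
    then show "\<forall>\<^sub>F h in at 0. operator_norm M (E h)
        \<le> B * B * \<delta> h + \<bar>h\<bar> * (B * B * B * a * (\<delta> h + a))"
      by (auto simp: eventually_at_filter)
    have "((\<lambda>h. B * B * \<delta> h + \<bar>h\<bar> * (B * B * B * a * (\<delta> h + a)))
        \<longlongrightarrow> B * B * 0 + \<bar>0\<bar> * (B * B * B * a * (0 + a))) (at 0)"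
      by (intro tendsto_intros \<delta>_lim)
    then show "((\<lambda>h. B * B * \<delta> h + \<bar>h\<bar> * (B * B * B * a * (\<delta> h + a))) \<longlongrightarrow> 0) (at 0)"
      by simp
  qed simp
  then show ?thesis
    unfolding has_frechet_derivative_def E_def using C_bounded CHC by blast
qed

end

section \<open>Completeness of the space of square-integrable functions\<close>

lemma sq_integrable_diff:
  assumes "sq_integrable N f" "sq_integrable N g"
  shows "sq_integrable N (\<lambda>x. f x - g x)"
  using sq_integrable_add[OF assms(1) sq_integrable_scale[OF assms(2), of "-1"]] by simp

lemma nn_integral_sq_diff:
  assumes "sq_integrable N f" "sq_integrable N g"
  shows "(\<integral>\<^sup>+x. ennreal ((f x - g x)\<^sup>2) \<partial>N) = ennreal (LINT x|N. (f x - g x)\<^sup>2)"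
  using sq_integrable_diff[OF assms] by (intro nn_integral_eq_integral) (auto simp: sq_integrable_def)

text \<open>
  On a space of infinite measure an \<open>L\<^sup>2\<close> bound on the increments gives no \<open>L\<^sup>1\<close> bound on them.
  The weights \<open>2 ^ k\<close> avoid this: the sum of the weighted squares of the increments is integrable, hence
  finite almost everywhere, and each increment \<open>e\<close> is at most \<open>2 ^ k * e\<^sup>2 + (1 / 2) ^ k\<close>.
\<close>

lemma fast_cauchy_AE_convergent:
  fixes f :: "nat \<Rightarrow> 'a \<Rightarrow> real"
  assumes f: "\<And>k. sq_integrable N (f k)"
    and fast: "\<And>k. (LINT x|N. (f (Suc k) x - f k x)\<^sup>2) \<le> (1 / 4) ^ k"
  shows "AE x in N. convergent (\<lambda>k. f k x)"
proof -
  have [measurable]: "f k \<in> borel_measurable N" for k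
    using f by (simp add: sq_integrable_def)
  let ?e = "\<lambda>k x. f (Suc k) x - f k x"
  have "(\<integral>\<^sup>+x. (\<Sum>k. ennreal (2 ^ k * (?e k x)\<^sup>2)) \<partial>N) = (\<Sum>k. \<integral>\<^sup>+x. ennreal (2 ^ k * (?e k x)\<^sup>2) \<partial>N)"
    by (rule nn_integral_suminf) measurable
  also have "\<dots> \<le> (\<Sum>k. ennreal ((1 / 2) ^ k))"
  proof (rule suminf_le)
    fix k
    have "(\<integral>\<^sup>+x. ennreal (2 ^ k * (?e k x)\<^sup>2) \<partial>N) = ennreal (2 ^ k) * (\<integral>\<^sup>+x. ennreal ((?e k x)\<^sup>2) \<partial>N)"
      by (simp add: ennreal_mult nn_integral_cmult)
    also have "\<dots> = ennreal (2 ^ k * (LINT x|N. (?e k x)\<^sup>2))"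
      by (simp add: nn_integral_sq_diff[OF f f] ennreal_mult)
    also have "\<dots> \<le> ennreal (2 ^ k * (1 / 4) ^ k)"
      using fast[of k] by (intro ennreal_leI mult_left_mono) auto
    also have "(2::real) ^ k * (1 / 4) ^ k = (1 / 2) ^ k"
      by (simp flip: power_mult_distrib)
    finally show "(\<integral>\<^sup>+x. ennreal (2 ^ k * (?e k x)\<^sup>2) \<partial>N) \<le> ennreal ((1 / 2) ^ k)" .
  qed auto
  also have "\<dots> < \<infinity>"
    by (subst suminf_ennreal2) (auto simp: summable_geometric)
  finally have "AE x in N. (\<Sum>k. ennreal (2 ^ k * (?e k x)\<^sup>2)) \<noteq> \<infinity>"
    by (intro nn_integral_PInf_AE) auto
  then show ?thesis
  proof eventually_elim
    fix x assume "(\<Sum>k. ennreal (2 ^ k * (?e k x)\<^sup>2)) \<noteq> \<infinity>"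
    then have "summable (\<lambda>k. 2 ^ k * (?e k x)\<^sup>2)"
      by (intro summable_suminf_not_top) auto
    then have s: "summable (\<lambda>k. 2 ^ k * (?e k x)\<^sup>2 + (1 / 2) ^ k)"
      by (intro summable_add summable_geometric) auto
    have "summable (\<lambda>k. ?e k x)"
    proof (rule summable_comparison_test'[OF s, of 0])
      fix k :: nat
      define p :: real where "p = 2 ^ k"
      have p: "0 < p" by (simp add: p_def)
      \<comment> \<open>The inequality between arithmetic and geometric mean, without its factor 2.\<close>
      have "0 \<le> (p * \<bar>?e k x\<bar> - 1)\<^sup>2" by simp
      then have "2 * (p * \<bar>?e k x\<bar>) \<le> p\<^sup>2 * (?e k x)\<^sup>2 + 1"
        by (simp add: power2_diff power_mult_distrib)
      moreover have "0 \<le> p * \<bar>?e k x\<bar>" using p by simp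
      ultimately have "p * \<bar>?e k x\<bar> \<le> p\<^sup>2 * (?e k x)\<^sup>2 + 1"
        by linarith
      also have "\<dots> = p * (p * (?e k x)\<^sup>2 + 1 / p)"
        using p by (simp add: distrib_left power2_eq_square mult.assoc)
      finally have "p * \<bar>?e k x\<bar> \<le> p * (p * (?e k x)\<^sup>2 + 1 / p)" .
      then have "\<bar>?e k x\<bar> \<le> p * (?e k x)\<^sup>2 + 1 / p"
        using p by (simp only: mult_le_cancel_left_pos)
      then show "norm (?e k x) \<le> 2 ^ k * (?e k x)\<^sup>2 + (1 / 2) ^ k"
        by (simp add: p_def power_one_over)
    qed
    then have "convergent (\<lambda>n. \<Sum>k<n. ?e k x)"
      by (simp add: summable_iff_convergent)
    then have "convergent (\<lambda>n. f n x - f 0 x)"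
      by (simp only: sum_lessThan_telescope[of "\<lambda>k. f k x"])
    then show "convergent (\<lambda>n. f n x)"
      using convergent_add[OF _ convergent_const[of "f 0 x"], of "\<lambda>n. f n x - f 0 x"] by simp
  qed
qed

text \<open>
  A fast subsequence converges almost everywhere, and Fatou's lemma along that subsequence turns the Cauchy
  condition for the whole sequence into convergence to its pointwise limit.
\<close>

lemma Riesz_Fischer:
  fixes f :: "nat \<Rightarrow> 'a \<Rightarrow> real"
  assumes f: "\<And>n. sq_integrable N (f n)"
    and cauchy: "\<And>e. 0 < e \<Longrightarrow> \<exists>n0. \<forall>m\<ge>n0. \<forall>n\<ge>n0. (LINT x|N. (f m x - f n x)\<^sup>2) \<le> e"
  obtains g where "sq_integrable N g" "(\<lambda>n. LINT x|N. (f n x - g x)\<^sup>2) \<longlonglongrightarrow> 0"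
proof -
  have fm[measurable]: "f k \<in> borel_measurable N" for k
    using f by (simp add: sq_integrable_def)
  obtain n0 where n0: "\<And>e m n. 0 < e \<Longrightarrow> n0 e \<le> m \<Longrightarrow> n0 e \<le> n \<Longrightarrow> (LINT x|N. (f m x - f n x)\<^sup>2) \<le> e"
    using cauchy by metis
  \<comment> \<open>Adding up the thresholds passes each of them and keeps \<open>r\<close> monotone; \<open>k\<close> makes it unbounded.\<close>
  define r where "r k = k + (\<Sum>j\<le>k. n0 ((1 / 4) ^ j))" for k
  have r_ge: "n0 ((1 / 4) ^ k) \<le> r k" for k
    unfolding r_def by (intro trans_le_add2 member_le_sum) auto
  have r_Suc: "r k \<le> r (Suc k)" for k
    by (simp add: r_def)
  have "AE x in N. convergent (\<lambda>k. f (r k) x)"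
  proof (rule fast_cauchy_AE_convergent[OF f])
    show "(LINT x|N. (f (r (Suc k)) x - f (r k) x)\<^sup>2) \<le> (1 / 4) ^ k" for k
      using r_ge[of k] r_Suc[of k] by (intro n0) auto
  qed
  then have conv: "AE x in N. (\<lambda>k. f (r k) x) \<longlonglongrightarrow> lim (\<lambda>k. f (r k) x)"
    by (simp add: convergent_LIMSEQ_iff)
  define g where "g x = lim (\<lambda>k. f (r k) x)" for x
  have gm[measurable]: "g \<in> borel_measurable N"
    unfolding g_def by measurable
  have fatou: "(\<integral>\<^sup>+x. ennreal ((f n x - g x)\<^sup>2) \<partial>N) \<le> ennreal e" if e: "0 < e" and n: "n0 e \<le> n" for e n
  proof -
    have "(\<integral>\<^sup>+x. ennreal ((f n x - g x)\<^sup>2) \<partial>N) = (\<integral>\<^sup>+x. liminf (\<lambda>k. ennreal ((f n x - f (r k) x)\<^sup>2)) \<partial>N)"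
    proof (rule nn_integral_cong_AE)
      show "AE x in N. ennreal ((f n x - g x)\<^sup>2) = liminf (\<lambda>k. ennreal ((f n x - f (r k) x)\<^sup>2))"
        using conv
      proof eventually_elim
        fix x assume "(\<lambda>k. f (r k) x) \<longlonglongrightarrow> lim (\<lambda>k. f (r k) x)"
        then have "(\<lambda>k. ennreal ((f n x - f (r k) x)\<^sup>2)) \<longlonglongrightarrow> ennreal ((f n x - g x)\<^sup>2)"
          unfolding g_def by (intro tendsto_intros)
        then show "ennreal ((f n x - g x)\<^sup>2) = liminf (\<lambda>k. ennreal ((f n x - f (r k) x)\<^sup>2))"
          by (intro lim_imp_Liminf[symmetric]) auto
      qed
    qed
    also have "\<dots> \<le> liminf (\<lambda>k. \<integral>\<^sup>+x. ennreal ((f n x - f (r k) x)\<^sup>2) \<partial>N)"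
      by (rule nn_integral_liminf) measurable
    also have "\<dots> \<le> ennreal e"
    proof (rule Liminf_le)
      have "\<forall>\<^sub>F k in sequentially. n0 e \<le> r k"
        using eventually_ge_at_top[of "n0 e"] by eventually_elim (simp add: r_def)
      then show "\<forall>\<^sub>F k in sequentially. (\<integral>\<^sup>+x. ennreal ((f n x - f (r k) x)\<^sup>2) \<partial>N) \<le> ennreal e"
        by eventually_elim (simp add: nn_integral_sq_diff[OF f f] n0[OF e n] ennreal_leI)
    qed simp
    finally show ?thesis .
  qed
  have diff: "sq_integrable N (\<lambda>x. f n x - g x)" if e: "0 < e" "n0 e \<le> n" for e n
  proof -
    have "(\<integral>\<^sup>+x. ennreal ((f n x - g x)\<^sup>2) \<partial>N) < \<infinity>"
      using fatou[OF e] by (simp add: le_less_trans)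
    then show ?thesis
      by (auto simp: sq_integrable_def intro!: integrableI_nonneg)
  qed
  have g: "sq_integrable N g"
    using sq_integrable_diff[OF f[of "n0 1"] diff[of 1 "n0 1"]] by simp
  have "(\<lambda>n. LINT x|N. (f n x - g x)\<^sup>2) \<longlonglongrightarrow> 0"
  proof (rule LIMSEQ_I)
    fix e :: real assume e: "0 < e"
    have "(LINT x|N. (f n x - g x)\<^sup>2) \<le> e / 2" if n: "n0 (e / 2) \<le> n" for n
      using fatou[of "e / 2" n] e n by (simp add: nn_integral_sq_diff[OF f g])
    then show "\<exists>no. \<forall>n\<ge>no. norm ((LINT x|N. (f n x - g x)\<^sup>2) - 0) < e"
      using e by (intro exI[of _ "n0 (e / 2)"]) (force simp: abs_of_nonneg)
  qed
  then show ?thesis using g that by blast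
qed

lemma L2_class_add:
  assumes "\<Omega> \<in> sets lebesgue" "sq_integrable (lebesgue_on \<Omega>) f" "sq_integrable (lebesgue_on \<Omega>) g"
  shows "L2_class \<Omega> f + L2_class \<Omega> g = L2_class \<Omega> (\<lambda>x. f x + g x)"
proof -
  have "L2_class \<Omega> f + L2_class \<Omega> g
      = abs_plane_L2 (\<lambda>x. zero_extension \<Omega> f x + zero_extension \<Omega> g x)"
    unfolding L2_class_def
    using assms sq_integrable_zero_extension
    by (intro plus_plane_L2.abs_eq) (auto simp: L2_rel_def)
  also have "(\<lambda>x. zero_extension \<Omega> f x + zero_extension \<Omega> g x) = zero_extension \<Omega> (\<lambda>x. f x + g x)"
    by (auto simp: zero_extension_def)
  finally show ?thesis by (simp add: L2_class_def)
qed

lemma L2_class_scale: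
  assumes "\<Omega> \<in> sets lebesgue" "sq_integrable (lebesgue_on \<Omega>) f"
  shows "c *\<^sub>R L2_class \<Omega> f = L2_class \<Omega> (\<lambda>x. c * f x)"
proof -
  have "c *\<^sub>R L2_class \<Omega> f = abs_plane_L2 (\<lambda>x. c * zero_extension \<Omega> f x)"
    unfolding L2_class_def
    using assms sq_integrable_zero_extension
    by (intro scaleR_plane_L2.abs_eq) (auto simp: L2_rel_def)
  also have "(\<lambda>x. c * zero_extension \<Omega> f x) = zero_extension \<Omega> (\<lambda>x. c * f x)"
    by (auto simp: zero_extension_def)
  finally show ?thesis by (simp add: L2_class_def)
qed

lemma norm_L2_class_diff:
  assumes "\<Omega> \<in> sets lebesgue" "sq_integrable (lebesgue_on \<Omega>) f" "sq_integrable (lebesgue_on \<Omega>) g"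
  shows "(norm (L2_class \<Omega> f - L2_class \<Omega> g))\<^sup>2 = (LINT x|lebesgue_on \<Omega>. (f x - g x)\<^sup>2)"
proof -
  have "L2_class \<Omega> f - L2_class \<Omega> g = L2_class \<Omega> f + (-1) *\<^sub>R L2_class \<Omega> g"
    by simp
  also have "\<dots> = L2_class \<Omega> (\<lambda>x. f x - g x)"
    using L2_class_add[OF assms(1,2) sq_integrable_scale[OF assms(3), of "-1"]]
    by (simp add: L2_class_scale[OF assms(1,3)] del: scaleR_minus_left scaleR_one)
  finally show ?thesis
    using inner_L2_class[OF assms(1) sq_integrable_diff[OF assms(2,3)] sq_integrable_diff[OF assms(2,3)]]
    by (simp only: power2_norm_eq_inner) (simp add: power2_eq_square)
qed

lemma subspace_L2:
  assumes "\<Omega> \<in> sets lebesgue"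
  shows "subspace (L2 \<Omega>)"
proof (rule subspaceI)
  have "(0::plane_L2) = L2_class \<Omega> (\<lambda>x. 0)"
    using L2_class_scale[OF assms sq_integrable_zero, of 0] by simp
  then show "0 \<in> L2 \<Omega>"
    unfolding L2_def by (intro image_eqI[where x = "\<lambda>x. 0"]) (simp_all add: sq_integrable_zero)
qed (auto simp: L2_def L2_class_add[OF assms] L2_class_scale[OF assms]
      intro!: imageI sq_integrable_add sq_integrable_scale)

text \<open>
  The Riesz-Fischer theorem is applied to representatives on \<open>\<Omega>\<close>, with the measure restricted to
  \<open>\<Omega>\<close>, so the limit function is itself a representative of an element of \<open>L2 \<Omega>\<close>.
\<close>

lemma complete_L2:
  assumes \<Omega>: "\<Omega> \<in> sets lebesgue"
  shows "complete (L2 \<Omega>)"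
  unfolding complete_def
proof (intro allI impI, elim conjE)
  fix F :: "nat \<Rightarrow> plane_L2"
  assume "\<forall>n. F n \<in> L2 \<Omega>" and cauchy: "Cauchy F"
  then have "\<forall>n. \<exists>f. sq_integrable (lebesgue_on \<Omega>) f \<and> F n = L2_class \<Omega> f"
    by (auto simp: L2_def)
  then obtain f where f: "\<And>n. sq_integrable (lebesgue_on \<Omega>) (f n)" and F: "\<And>n. F n = L2_class \<Omega> (f n)"
    by metis
  have small: "\<exists>n0. \<forall>m\<ge>n0. \<forall>n\<ge>n0. (LINT x|lebesgue_on \<Omega>. (f m x - f n x)\<^sup>2) \<le> e" if e: "0 < e" for e
  proof -
    obtain n0 where n0: "\<And>m n. n0 \<le> m \<Longrightarrow> n0 \<le> n \<Longrightarrow> norm (F m - F n) < sqrt e"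
      using CauchyD[OF cauchy, of "sqrt e"] e by auto
    have "(LINT x|lebesgue_on \<Omega>. (f m x - f n x)\<^sup>2) \<le> e" if "n0 \<le> m" "n0 \<le> n" for m n
    proof -
      have "(norm (F m - F n))\<^sup>2 \<le> (sqrt e)\<^sup>2"
        using n0[OF that] by (intro power_mono) auto
      then show ?thesis
        using e by (simp add: F norm_L2_class_diff[OF \<Omega> f f])
    qed
    then show ?thesis by blast
  qed
  obtain g where g: "sq_integrable (lebesgue_on \<Omega>) g"
    and lim: "(\<lambda>n. LINT x|lebesgue_on \<Omega>. (f n x - g x)\<^sup>2) \<longlonglongrightarrow> 0"
    using Riesz_Fischer[where f = f, OF f small] by blast
  have "(\<lambda>n. sqrt ((norm (F n - L2_class \<Omega> g))\<^sup>2)) \<longlonglongrightarrow> sqrt 0"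
    using lim by (intro tendsto_real_sqrt) (simp add: F norm_L2_class_diff[OF \<Omega> f g])
  then have "(\<lambda>n. norm (F n - L2_class \<Omega> g)) \<longlonglongrightarrow> 0"
    by simp
  then have "F \<longlonglongrightarrow> L2_class \<Omega> g"
    by (rule LIM_zero_cancel[OF tendsto_norm_zero_cancel])
  then show "\<exists>l\<in>L2 \<Omega>. F \<longlonglongrightarrow> l"
    using g by (auto simp: L2_def)
qed

section \<open>Differentiation of the inverse operator\<close>

theorem theorem2:
  fixes \<Omega> :: "(real ^ 2) set"
    and M :: "plane_L2 set"
    and C\<^sub>0 :: "plane_L2 \<Rightarrow> plane_L2"
    and H\<^sub>0 H\<^sub>0' C :: "real \<Rightarrow> plane_L2 \<Rightarrow> plane_L2"
  assumes "open \<Omega>" and "bounded \<Omega>" and "convex \<Omega>"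
    and "M = L2 \<Omega>"
    and "bounded_operator M C\<^sub>0"
    and "self_adjoint M C\<^sub>0"
    and "strictly_positive_operator M C\<^sub>0"
    and "\<And>\<xi>. bounded_operator M (H\<^sub>0 \<xi>)"
    and "\<And>\<xi>. self_adjoint M (H\<^sub>0 \<xi>)"
    and "\<And>\<xi>. positive_operator M (H\<^sub>0 \<xi>)"
    and "\<And>\<xi>. C \<xi> = inverse_sum_op M C\<^sub>0 H\<^sub>0 \<xi>"
    and "\<And>\<xi>. has_frechet_derivative M H\<^sub>0 (H\<^sub>0' \<xi>) \<xi>"
  shows "\<forall>\<xi>. has_frechet_derivative M C (\<lambda>f. - C \<xi> (H\<^sub>0' \<xi> (C \<xi> f))) \<xi>"
proof -
  have \<Omega>: "\<Omega> \<in> sets lebesgue"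
    using assms(1) by (simp add: borel_open sets_completionI_sets)
  interpret positive_perturbation M C\<^sub>0 H\<^sub>0
    using assms subspace_L2[OF \<Omega>] complete_L2[OF \<Omega>] by unfold_locales auto
  have C: "C = inverse_sum_op M C\<^sub>0 H\<^sub>0"
    using assms(11) by (rule ext)
  show ?thesis
    unfolding C using inverse_sum_op_has_frechet_derivative[OF assms(12)] by blast
qed

end
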